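(* Let $r,n$ be positive integers and $p,p',q,q'$ positive divisors of $r$ with $pq=p'q'$ dividing $rn$, and assume $\mathrm{GCD}(p,n)=\mathrm{GCD}(p',n)$ and $\mathrm{GCD}(q,n)=\mathrm{GCD}(q',n)$. For each prime $\pi$ let $a_\pi,a'_\pi,b'_\pi,c_\pi,d_\pi$ denote the multiplicities of $\pi$ in $p,p',q',r,n$ respectively. Let $x$ be an integer such that for every prime $\pi$ dividing $rn$: if $a_\pi=a'_\pi$ then $x\equiv 0\pmod{\pi^{a_\pi+1}}$; if $a_\pi>a'_\pi$ then $x\equiv \pi^{a'_\pi-d_\pi}\pmod{\pi^{a'_\pi-d_\pi+1}}$; if $a_\pi<a'_\pi$ then $\frac{rn}{pq}x+\frac{r}{q}\equiv\pi^{c_\pi-b'_\pi}\pmod{\pi^{c_\pi-b'_\pi+1}}$ (such an integer exists). Then the map $\varphi:G(r,p,n)\to G(r,p',q',n)$ sending $g$ to the image in $G(r,p',q',n)$ of $g\cdot c^{\frac{\Delta(g)}{p}x}$ (where $\Delta(g)$ is represented by any integer, necessarily a multiple of $p$) is a well-defined surjective group homomorphism whose kernel is $C_q=\langle c^{r/q}\rangle$. In particular it induces an isomorphism $G(r,p,q,n)\cong G(r,p',q',n)$.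
   Context: For a positive integer $r$ let $\zeta_r=\exp(2\pi\sqrt{-1}/r)$ and $\mathbb{Z}_r=\mathbb{Z}/r\mathbb{Z}$. $G(r,n)$ is the group of $n\times n$ complex matrices with exactly one nonzero entry in each row and column, each nonzero entry an $r$th root of unity; its elements are written $(\pi,x)$ with $\pi\in S_n$, $x\in(\mathbb{Z}_r)^n$, meaning the matrix whose $i$th column has $\zeta_r^{x_i}$ in row $\pi(i)$. Put $\Delta(\pi,x)=\sum_i x_i\in\mathbb{Z}_r$. For $p\mid r$, $G(r,p,n)=\{g\in G(r,n):\Delta(g)\in p\mathbb{Z}_r\}$. Let $c=\zeta_rI_n$. When $p,q\mid r$ and $pq\mid rn$ the group $C_q=\langle c^{r/q}\rangle$ is central of order $q$ in $G(r,p,n)$ and $G(r,p,q,n):=G(r,p,n)/C_q$. The multiplicity of a prime $\pi$ in $k$ is the largest $e$ with $\pi^e\mid k$. *)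

theory Defs
  imports
    "Jordan_Normal_Form.Matrix"
    "HOL-Algebra.IntRing"
    "HOL-Algebra.Generated_Groups"
    "HOL-Combinatorics.Permutations"
    "HOL-Number_Theory.Cong"
begin

definition zeta :: "nat \<Rightarrow> complex" where
  "zeta r = exp (2 * of_real pi * \<i> / of_nat r)"

definition G_full :: "nat \<Rightarrow> nat \<Rightarrow> complex mat monoid" where
  "G_full r n =
    \<lparr>carrier = {A \<in> carrier_mat n n.
        (\<forall>i<n. \<exists>!j. j < n \<and> A $$ (i, j) \<noteq> 0) \<and>
        (\<forall>j<n. \<exists>!i. i < n \<and> A $$ (i, j) \<noteq> 0) \<and>
        (\<forall>i<n. \<forall>j<n. A $$ (i, j) \<noteq> 0 \<longrightarrow> A $$ (i, j) ^ r = 1)},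
     mult = (*),
     one = 1\<^sub>m n\<rparr>"

text \<open>The matrix written \<open>(\<sigma>, x)\<close>. Rows and columns are indexed by \<open>0, \<dots>, n - 1\<close>, and an
  element of \<open>\<int>/r\<close> is given by any integer representing it.\<close>

definition monomial_mat :: "nat \<Rightarrow> nat \<Rightarrow> (nat \<Rightarrow> nat) \<Rightarrow> (nat \<Rightarrow> int) \<Rightarrow> complex mat" where
  "monomial_mat r n \<sigma> x = mat n n (\<lambda>(i, j). if i = \<sigma> j then zeta r powi x j else 0)"

text \<open>\<open>ZMod (int r) k\<close> is the class of \<open>k\<close> in \<open>\<int>/r\<close>, as a set of integers. So \<open>\<Delta>(g)\<close> is a set of
  integers, and \<open>k \<in> \<Delta>(g)\<close> says that \<open>k\<close> represents \<open>\<Delta>(g)\<close>. The description below is unique;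
  see \<open>Delta_monomial_mat\<close>.\<close>

definition Delta :: "nat \<Rightarrow> nat \<Rightarrow> complex mat \<Rightarrow> int set" where
  "Delta r n g = (THE D. \<exists>\<sigma> x. \<sigma> permutes {..<n} \<and> g = monomial_mat r n \<sigma> x \<and>
                              D = ZMod (int r) (\<Sum>i<n. x i))"

definition G_sub :: "nat \<Rightarrow> nat \<Rightarrow> nat \<Rightarrow> complex mat monoid" where
  "G_sub r p n =
    (G_full r n)\<lparr>carrier := {g \<in> carrier (G_full r n).
                            Delta r n g \<in> {ZMod (int r) (int p * y) | y. True}}\<rparr>"

definition c_elt :: "nat \<Rightarrow> nat \<Rightarrow> complex mat" where
  "c_elt r n = zeta r \<cdot>\<^sub>m 1\<^sub>m n"

definition C_sub :: "nat \<Rightarrow> nat \<Rightarrow> nat \<Rightarrow> complex mat set" where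
  "C_sub r q n = generate (G_full r n) {c_elt r n [^]\<^bsub>G_full r n\<^esub> (r div q)}"

definition G_quot :: "nat \<Rightarrow> nat \<Rightarrow> nat \<Rightarrow> nat \<Rightarrow> complex mat set monoid" where
  "G_quot r p q n = G_sub r p n Mod C_sub r q n"

text \<open>The matrix \<open>g c\<^bsup>(k/p)x\<^esup>\<close>, for an integer \<open>k\<close> divisible by \<open>p\<close>. The power is taken in
  \<open>G(r,n)\<close>, since \<open>c\<close> need not lie in \<open>G(r,p,n)\<close>.\<close>

definition twist :: "nat \<Rightarrow> nat \<Rightarrow> nat \<Rightarrow> int \<Rightarrow> complex mat \<Rightarrow> int \<Rightarrow> complex mat" where
  "twist r p n x g k =
    g \<otimes>\<^bsub>G_full r n\<^esub> (c_elt r n [^]\<^bsub>G_full r n\<^esub> (k div int p * x))"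

text \<open>That the coset below does not depend on \<open>k\<close> is the well-definedness of \<open>\<phi>\<close>.\<close>

definition phi :: "nat \<Rightarrow> nat \<Rightarrow> nat \<Rightarrow> nat \<Rightarrow> nat \<Rightarrow> int \<Rightarrow> complex mat \<Rightarrow> complex mat set" where
  "phi r p p' q' n x g =
    (THE Y. \<exists>k \<in> Delta r n g. Y = C_sub r q' n #>\<^bsub>G_sub r p' n\<^esub> twist r p n x g k)"

text \<open>Let \<open>a, a', b', c, d\<close> be the multiplicities of \<open>\<pi>\<close> in \<open>p, p', q', r, n\<close>. Under the hypotheses
  of the theorem none of the natural number subtractions truncates: if \<open>a > a'\<close> then
  \<open>gcd p n = gcd p' n\<close> gives \<open>d \<le> a'\<close>, and \<open>b' \<le> c\<close> as \<open>q'\<close> divides \<open>r\<close>. The divisions are exact.\<close>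

definition admissible :: "nat \<Rightarrow> nat \<Rightarrow> nat \<Rightarrow> nat \<Rightarrow> nat \<Rightarrow> nat \<Rightarrow> int \<Rightarrow> bool" where
  "admissible r n p q p' q' x \<longleftrightarrow>
    (\<forall>\<pi>::nat. Factorial_Ring.prime \<pi> \<and> \<pi> dvd r * n \<longrightarrow>
      (let a = multiplicity \<pi> p; a' = multiplicity \<pi> p'; b' = multiplicity \<pi> q';
           c = multiplicity \<pi> r; d = multiplicity \<pi> n
       in (a = a' \<longrightarrow> [x = 0] (mod int (\<pi> ^ (a + 1)))) \<and>
          (a > a' \<longrightarrow> [x = int (\<pi> ^ (a' - d))] (mod int (\<pi> ^ (a' - d + 1)))) \<and>
          (a < a' \<longrightarrow> [int (r * n div (p * q)) * x + int (r div q) = int (\<pi> ^ (c - b'))]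
                        (mod int (\<pi> ^ (c - b' + 1))))))"

lemma mem_ZMod_iff: "k \<in> ZMod m l \<longleftrightarrow> [k = l] (mod m)"
proof
  assume "k \<in> ZMod m l"
  from rcos_zfact[OF this] show "[k = l] (mod m)"
    by (auto simp: cong_def)
next
  assume "[k = l] (mod m)"
  then have "m dvd k - l"
    by (simp add: cong_iff_dvd_diff)
  then obtain y where "k - l = y * m"
    by (metis dvd_def mult.commute)
  then have "k = y * m + l"
    by simp
  then show "k \<in> ZMod m l"
    by (auto simp: ZMod_def int_Idl a_r_coset_defs)
qed

lemma zeta_nonzero: "zeta r \<noteq> 0"
  by (simp add: zeta_def)

lemma zeta_powi: "zeta r powi k = cis (2 * pi * of_int k / of_nat r)"
proof -
  have z: "zeta r = cis (2 * pi / of_nat r)"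
    by (simp add: zeta_def cis_conv_exp mult_ac)
  show ?thesis
    by (simp add: z cis_power_int mult_ac)
qed

lemma zeta_powi_eq_iff:
  assumes "r > 0"
  shows "zeta r powi k = zeta r powi l \<longleftrightarrow> [k = l] (mod int r)"
proof -
  have "zeta r powi k = zeta r powi l \<longleftrightarrow> zeta r powi (k - l) = 1"
    by (simp add: power_int_diff zeta_nonzero)
  also have "\<dots> \<longleftrightarrow> cos (2 * pi * of_int (k - l) / of_nat r) = 1"
    unfolding zeta_powi complex_eq_iff
    by (simp del: of_int_diff) (blast intro: cos_one_sin_zero)
  also have "\<dots> \<longleftrightarrow> (\<exists>m::int. 2 * pi * of_int (k - l) / of_nat r = of_int m * 2 * pi)"
    by (simp only: cos_one_2pi_int)
  also have "\<dots> \<longleftrightarrow> (\<exists>m::int. real_of_int (k - l) = real_of_int (m * int r))"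
  proof (rule ex_cong1)
    fix m :: int
    have "2 * pi * of_int (k - l) / of_nat r = of_int m * 2 * pi
        \<longleftrightarrow> (2 * pi) * of_int (k - l) = (2 * pi) * (of_int m * real r)"
      using assms by (simp add: divide_eq_eq mult_ac)
    also have "\<dots> \<longleftrightarrow> real_of_int (k - l) = of_int m * real r"
      by (subst mult_cancel_left) simp
    finally show "2 * pi * of_int (k - l) / of_nat r = of_int m * 2 * pi
        \<longleftrightarrow> real_of_int (k - l) = real_of_int (m * int r)"
      by simp
  qed
  also have "\<dots> \<longleftrightarrow> (\<exists>m. k - l = m * int r)"
    by (simp only: of_int_eq_iff)
  also have "\<dots> \<longleftrightarrow> [k = l] (mod int r)"
    unfolding cong_iff_dvd_diff dvd_def by (simp add: mult.commute)
  finally show ?thesis .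
qed

lemma Delta_monomial_mat:
  assumes r: "r > 0" and s: "\<sigma> permutes {..<n}"
  shows "Delta r n (monomial_mat r n \<sigma> x) = ZMod (int r) (\<Sum>i<n. x i)"
  unfolding Delta_def
proof (rule the_equality)
  show "\<exists>\<tau> y. \<tau> permutes {..<n} \<and> monomial_mat r n \<sigma> x = monomial_mat r n \<tau> y \<and>
          ZMod (int r) (\<Sum>i<n. x i) = ZMod (int r) (\<Sum>i<n. y i)"
    using s by blast
next
  fix D
  assume "\<exists>\<tau> y. \<tau> permutes {..<n} \<and> monomial_mat r n \<sigma> x = monomial_mat r n \<tau> y \<and>
          D = ZMod (int r) (\<Sum>i<n. y i)"
  then obtain \<tau> y where t: "\<tau> permutes {..<n}"
    and eq: "monomial_mat r n \<sigma> x = monomial_mat r n \<tau> y"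
    and D: "D = ZMod (int r) (\<Sum>i<n. y i)"
    by blast
  have "[y j = x j] (mod int r)" if j: "j < n" for j
  proof -
    have "\<sigma> j < n"
      using permutes_in_image[OF s, of j] j by simp
    then have "monomial_mat r n \<sigma> x $$ (\<sigma> j, j) = zeta r powi x j"
      and "monomial_mat r n \<tau> y $$ (\<sigma> j, j) = (if \<sigma> j = \<tau> j then zeta r powi y j else 0)"
      using j by (auto simp: monomial_mat_def)
    with eq have "zeta r powi y j = zeta r powi x j"
      by (auto simp: zeta_nonzero split: if_splits)
    then show ?thesis
      by (simp add: zeta_powi_eq_iff[OF r])
  qed
  then have "[(\<Sum>i<n. y i) = (\<Sum>i<n. x i)] (mod int r)"
    by (intro cong_sum) auto
  then show "D = ZMod (int r) (\<Sum>i<n. x i)"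
    unfolding D cong_def by (rule zmod_imp_ZMod)
qed

end

theory Submission
  imports Defs
begin

text \<open>Comparing multiplicities prime by prime, the congruences defining \<open>x\<close> imply that
  \<open>p + n x = p' u\<close> with \<open>u\<close> prime to \<open>r\<close>, and that \<open>p\<close> divides \<open>q' x\<close>. The rest uses only these
  two facts. If \<open>k\<close> represents \<open>\<Delta>(g)\<close>, then \<open>(k/p) p' u\<close> represents \<open>\<Delta>(g c\<^bsup>(k/p)x\<^esup>)\<close>, so the
  image lies in \<open>G(r,p',n)\<close>; replacing \<open>k\<close> by \<open>k + r\<close> multiplies it by \<open>c\<^bsup>(r/p)x\<^esup>\<close>, which lies in
  \<open>C\<^bsub>q'\<^esub>\<close> as \<open>p\<close> divides \<open>q' x\<close>. An element of the kernel is a power \<open>c\<^bsup>j\<^esup>\<close>, mapped to the class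
  of \<open>c\<^bsup>j p' u/p\<^esup>\<close>; as \<open>pq = p'q'\<close> and \<open>u\<close> is a unit modulo \<open>r\<close>, it is trivial iff \<open>r\<close> divides
  \<open>q j\<close>. Surjectivity again comes from the invertibility of \<open>u\<close>.\<close>

section \<open>Multiplicities\<close>

lemma multiplicity_uminus_int: "multiplicity k (- x) = multiplicity k x" for k x :: int
  by (simp add: multiplicity_def)

lemma multiplicity_int_nat:
  "multiplicity (int p) (int m) = multiplicity p m" if "m \<noteq> 0" "p \<noteq> 1"
proof (rule multiplicity_eqI)
  show "int p ^ multiplicity p m dvd int m"
    by (metis int_dvd_int_iff multiplicity_dvd of_nat_power)
  have "finite {k. p ^ k dvd m}"
    using that by (intro finite_divisor_powers) auto
  then have "\<not> p ^ Suc (multiplicity p m) dvd m"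
    using that by (simp add: power_dvd_iff_le_multiplicity del: power_Suc)
  then show "\<not> int p ^ Suc (multiplicity p m) dvd int m"
    by (metis int_dvd_int_iff of_nat_power)
qed

text \<open>The modulus lies one power above \<pi>^e, so \<pi>^e divides x and \<pi>^(e+1) does not.
  In this way the congruences in \<open>admissible\<close> become exact multiplicities.\<close>

lemma multiplicity_cong_prime_power:
  fixes x \<pi> :: int
  assumes \<pi>: "Factorial_Ring.prime \<pi>" and x: "[x = \<pi> ^ e] (mod \<pi> ^ (e + 1))"
  shows "x \<noteq> 0" "multiplicity \<pi> x = e"
proof -
  have "\<not> \<pi> ^ (e + 1) dvd \<pi> ^ e"
    using \<pi> by (metis dvd_power_iff less_add_one linorder_not_less not_prime_0 not_prime_unit)
  then have *: "\<not> \<pi> ^ Suc e dvd x"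
    using x by (simp add: cong_dvd_iff)
  then show "x \<noteq> 0" by auto
  have "\<pi> ^ e dvd x"
    using cong_dvd_modulus[OF x, of "\<pi> ^ e"] by (simp add: cong_dvd_iff)
  with * show "multiplicity \<pi> x = e"
    by (intro multiplicity_eqI)
qed

text \<open>Only the prime divisors of k have to be tested, since k has multiplicity 0 at every
  other prime.\<close>

lemma int_dvd_if_prime_powers_dvd:
  assumes "k > 0" and "\<And>\<pi>. Factorial_Ring.prime \<pi> \<Longrightarrow> \<pi> dvd k \<Longrightarrow> int (\<pi> ^ multiplicity \<pi> k) dvd y"
  shows "int k dvd y"
proof (cases "y = 0")
  case False
  have "k dvd nat \<bar>y\<bar>"
  proof (rule multiplicity_le_imp_dvd)
    fix \<pi> :: nat assume \<pi>: "Factorial_Ring.prime \<pi>"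
    show "multiplicity \<pi> k \<le> multiplicity \<pi> (nat \<bar>y\<bar>)"
    proof (cases "\<pi> dvd k")
      case True
      then have "\<pi> ^ multiplicity \<pi> k dvd nat \<bar>y\<bar>"
        using assms(2)[OF \<pi> True] by (simp add: nat_dvd_iff)
      then show ?thesis
        using False \<pi> by (intro multiplicity_geI) auto
    qed (simp add: not_dvd_imp_multiplicity_0)
  qed (use assms in auto)
  then show ?thesis by (simp add: dvd_nat_abs_iff)
qed simp

section \<open>The hypotheses and congruences at a single prime\<close>

locale admissible_data =
  fixes r n p p' q q' :: nat
  assumes r: "r > 0" and n: "n > 0"
    and dvds: "p dvd r" "p' dvd r" "q dvd r" "q' dvd r"
    and pq: "p * q = p' * q'" and pq_dvd: "p * q dvd r * n"
    and gcds: "gcd p n = gcd p' n" "gcd q n = gcd q' n"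
begin

lemma pos: "p > 0" "p' > 0" "q > 0" "q' > 0"
  using r dvds by (auto intro!: Nat.gr0I)

text \<open>Write a, a', b, b', c, d for the multiplicities in p, p', q, q', r, n. The gcd
  hypotheses become equations between minima. If a \<noteq> a', they force d \<le> a and d \<le> a';
  then b \<noteq> b' as well, so that d \<le> b and d \<le> b'.\<close>

lemma multiplicity_relations:
  assumes "Factorial_Ring.prime \<pi>"
  shows "multiplicity \<pi> p + multiplicity \<pi> q = multiplicity \<pi> p' + multiplicity \<pi> q'"
    and "multiplicity \<pi> p + multiplicity \<pi> q \<le> multiplicity \<pi> r + multiplicity \<pi> n"
    and "multiplicity \<pi> q \<le> multiplicity \<pi> r"
    and "multiplicity \<pi> q' \<le> multiplicity \<pi> r"
    and "min (multiplicity \<pi> p) (multiplicity \<pi> n) = min (multiplicity \<pi> p') (multiplicity \<pi> n)"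
    and "min (multiplicity \<pi> q) (multiplicity \<pi> n) = min (multiplicity \<pi> q') (multiplicity \<pi> n)"
proof -
  have m: "multiplicity \<pi> (k * l) = multiplicity \<pi> k + multiplicity \<pi> l" if "k > 0" "l > 0" for k l
    using that assms by (simp add: prime_elem_multiplicity_mult_distrib)
  show "multiplicity \<pi> p + multiplicity \<pi> q = multiplicity \<pi> p' + multiplicity \<pi> q'"
    using m pos pq by metis
  show "multiplicity \<pi> p + multiplicity \<pi> q \<le> multiplicity \<pi> r + multiplicity \<pi> n"
    using dvd_imp_multiplicity_le[OF pq_dvd, of \<pi>] m pos r n by simp
  show "multiplicity \<pi> q \<le> multiplicity \<pi> r" "multiplicity \<pi> q' \<le> multiplicity \<pi> r"
    using dvd_imp_multiplicity_le dvds r by auto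
  show "min (multiplicity \<pi> p) (multiplicity \<pi> n) = min (multiplicity \<pi> p') (multiplicity \<pi> n)"
    "min (multiplicity \<pi> q) (multiplicity \<pi> n) = min (multiplicity \<pi> q') (multiplicity \<pi> n)"
    using gcds assms pos n multiplicity_gcd[of _ n \<pi>]  by (metis neq0_conv)+
qed

text \<open>Let v be the multiplicity of \<pi> and x \<noteq> 0. If a = a' then v(n x) > a, and if a
  > a' then v(n x) = a' < a; in both cases the term of smaller multiplicity decides v(p + n x). If a
  < a', the congruence is multiplied by p q, which turns its left side into r (p + n x). In each
  case v(x) is known well enough to give b' + v(x) \<ge> a.\<close>

lemma admissible_local:
  assumes x: "admissible r n p q p' q' x" and \<pi>: "Factorial_Ring.prime \<pi>" "\<pi> dvd r * n"
  shows "int p + int n * x \<noteq> 0"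
    and "multiplicity (int \<pi>) (int p + int n * x) = multiplicity \<pi> p'"
    and "int (\<pi> ^ multiplicity \<pi> p) dvd int q' * x"
proof -
  let ?P = "int \<pi>" and ?a = "multiplicity \<pi> p" and ?a' = "multiplicity \<pi> p'"
    and ?b = "multiplicity \<pi> q" and ?b' = "multiplicity \<pi> q'"
    and ?c = "multiplicity \<pi> r" and ?d = "multiplicity \<pi> n"
  note rel = multiplicity_relations[OF \<pi>(1)]
  have P: "Factorial_Ring.prime ?P" using \<pi> by simp
  have m0: "multiplicity ?P (int k) = multiplicity \<pi> k" if "k > 0" for k
    using that \<pi> by (intro multiplicity_int_nat) auto
  have m: "multiplicity ?P (k * l) = multiplicity ?P k + multiplicity ?P l"
    if "k \<noteq> 0" "l \<noteq> 0" for k l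
    using that P by (simp add: prime_elem_multiplicity_mult_distrib)
  have "(int p + int n * x \<noteq> 0 \<and> multiplicity (int \<pi>) (int p + int n * x) = multiplicity \<pi> p')
    \<and> int (\<pi> ^ multiplicity \<pi> p) dvd int q' * x"
  proof (cases "x = 0")
    case True
    \<comment> \<open>The value x = 0 is treated apart because 0 has multiplicity 0 by convention;
      it can occur only for a = a'.\<close>
    have "?a' = ?a"
    proof (rule ccontr)
      assume *: "?a' \<noteq> ?a"
      then consider "?a' < ?a" | "?a < ?a'" by linarith
      then show False
      proof cases
        case 1
        then have "[x = ?P ^ (?a' - ?d)] (mod ?P ^ (?a' - ?d + 1))"
          using x \<pi> unfolding admissible_def Let_def by simp
        with multiplicity_cong_prime_power[OF P] True show False by blast
      next
        case 2
        then have "[int (r div q) = ?P ^ (?c - ?b')] (mod ?P ^ (?c - ?b' + 1))"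
          using x \<pi> True unfolding admissible_def Let_def by simp
        then have "multiplicity ?P (int (r div q)) = ?c - ?b'"
          using multiplicity_cong_prime_power[OF P] by blast
        \<comment> \<open>But r/q has multiplicity c - b, so b = b', which with a + b = a' + b'
          contradicts a < a'.\<close>
        moreover have "?c = multiplicity \<pi> (r div q) + ?b"
          using \<pi> dvds r pos by (metis dvd_div_mult_self dvd_div_eq_0_iff neq0_conv prime_elem_multiplicity_mult_distrib prime_imp_prime_elem)
        moreover have "r div q > 0" using dvds r by (metis dvd_div_eq_0_iff neq0_conv)
        ultimately show False using rel 2 m0[of "r div q"] by simp
      qed
    qed
    then show ?thesis using True pos m0 by simp
  next
    case False
    consider "?a = ?a'" | "?a' < ?a" | "?a < ?a'" by linarith
    then show ?thesis
    proof cases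
      case 1
      then have "?P ^ (?a + 1) dvd x"
        using x \<pi> unfolding admissible_def Let_def by (simp add: cong_0_iff)
      then have "?a < multiplicity ?P x"
        using False P by (metis Suc_eq_plus1 Suc_le_eq multiplicity_geI not_prime_unit)
      then have "multiplicity ?P (int p) < multiplicity ?P (int n * x)"
        using m0 m[of "int n" x] pos n False by simp
      from multiplicity_sum_lt[OF this] have "multiplicity ?P (int p + int n * x) = ?a"
        using m0 pos n False by simp
      \<comment> \<open>The multiplicity alone does not exclude the value 0; but if the sum
        vanished, its two terms would have equal multiplicities.\<close>
      moreover have "int p + int n * x \<noteq> 0"
      proof
        assume "int p + int n * x = 0"
        then have "int n * x = - int p" by linarith
        with \<open>multiplicity ?P (int p) < multiplicity ?P (int n * x)\<close> show False
          by (simp add: multiplicity_uminus_int)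
      qed
      ultimately show ?thesis using 1 \<open>?P ^ (?a + 1) dvd x\<close> 
        by (simp add: dvd_mult power_Suc2 dvd_mult_left del: power_Suc)
    next
      case 2
      then have "[x = ?P ^ (?a' - ?d)] (mod ?P ^ (?a' - ?d + 1))"
        using x \<pi> unfolding admissible_def Let_def by simp
      then have vx: "multiplicity ?P x = ?a' - ?d"
        using multiplicity_cong_prime_power[OF P] by blast
      \<comment> \<open>As d \<le> a', the subtraction a' - d is exact, and n x has multiplicity d +
        (a' - d) = a' < a.\<close>
      have "multiplicity ?P (int n * x) < multiplicity ?P (int p)"
        using m0 m[of "int n" x] pos n False vx rel 2 by (simp add: min_def split: if_splits)
      note * = multiplicity_sum_lt[OF this]
      have "multiplicity ?P (int n * x + int p) = ?a'"
        using * m0 m[of "int n" x] pos n False vx rel 2 by (simp add: min_def split: if_splits)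
      moreover have "int n * x + int p \<noteq> 0"
      proof
        assume "int n * x + int p = 0"
        then have "int n * x = - int p" by linarith
        with \<open>multiplicity ?P (int n * x) < multiplicity ?P (int p)\<close> show False
          by (simp add: multiplicity_uminus_int)
      qed
      \<comment> \<open>Here b' + (a' - d) = a + b - d \<ge> a, because d \<le> b.\<close>
      moreover have "?P ^ ?a dvd int q' * x"
        using m0 m[of "int q'" x] pos False vx rel 2
        by (intro multiplicity_dvd') (simp add: min_def split: if_splits)
      ultimately show ?thesis by (simp add: add.commute)
    next
      case 3
      let ?s = "int (r * n div (p * q)) * x + int (r div q)"
      have "[?s = ?P ^ (?c - ?b')] (mod ?P ^ (?c - ?b' + 1))"
        using x \<pi> 3 unfolding admissible_def Let_def by simp
      then have s: "?s \<noteq> 0" "multiplicity ?P ?s = ?c - ?b'"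
        using multiplicity_cong_prime_power[OF P] by blast+
      \<comment> \<open>Clearing the denominators brings in p + n x, whose multiplicity is then a +
        b - b' = a'.\<close>
      have "int p * int q * ?s = int (p * q * (r * n div (p * q))) * x + int p * int (q * (r div q))"
        by (simp add: algebra_simps)
      also have "\<dots> = int r * (int p + int n * x)"
        unfolding dvd_mult_div_cancel[OF pq_dvd] dvd_mult_div_cancel[OF dvds(3)]
        by (simp add: algebra_simps)
      finally have e: "int p * int q * ?s = int r * (int p + int n * x)" .
      then have nz: "int p + int n * x \<noteq> 0" using s pos by auto
      have "?a + ?b + (?c - ?b') = ?c + multiplicity ?P (int p + int n * x)"
        using arg_cong[OF e, of "multiplicity ?P"] s nz m m0 pos r by simp
      then have v: "multiplicity ?P (int p + int n * x) = ?a'" using rel by simp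
      have vd: "?d \<le> ?a" "?d \<le> ?b'" using 3 rel by (auto simp: min_def split: if_splits)
      \<comment> \<open>In this sum p has the smaller multiplicity, so v(n x) = a and v(x) = a - d;
        with d \<le> b' the divisibility follows.\<close>
      have "int n * x = (int p + int n * x) + - int p" by simp
      then have "multiplicity ?P (int n * x) = ?a"
        using multiplicity_sum_lt[of ?P "- int p" "int p + int n * x"] v 3 m0 pos nz by (simp add: multiplicity_uminus_int)
      then have vx: "?d + multiplicity ?P x = ?a" using m[of "int n" x] m0 n False by simp
      have "?P ^ ?a dvd int q' * x"
        using m0 m[of "int q'" x] pos False vx vd
        by (intro multiplicity_dvd') simp
      with nz v show ?thesis by simp
    qed
  qed
  then show "int p + int n * x \<noteq> 0"
    and "multiplicity (int \<pi>) (int p + int n * x) = multiplicity \<pi> p'"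
    and "int (\<pi> ^ multiplicity \<pi> p) dvd int q' * x" by auto
qed

text \<open>Both divisibilities are checked at the primes dividing p' and p, which divide r. A
  common prime of u and r divides r n, so p + n x = p' u has the same multiplicity there as p';
  hence u would have multiplicity 0 at a prime dividing it.\<close>

lemma admissible_imp:
  assumes x: "admissible r n p q p' q' x"
  obtains u where "int p + int n * x = int p' * u" "coprime u (int r)" "int p dvd int q' * x"
proof -
  have "int p' dvd int p + int n * x"
  proof (rule int_dvd_if_prime_powers_dvd[OF pos(2)])
    fix \<pi> :: nat assume \<pi>: "Factorial_Ring.prime \<pi>" "\<pi> dvd p'"
    then have "\<pi> dvd r * n" using dvds by (metis dvd_trans dvd_mult2)
    then show "int (\<pi> ^ multiplicity \<pi> p') dvd int p + int n * x"
      using admissible_local(2)[OF x \<pi>(1)] by (metis multiplicity_dvd of_nat_power)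
  qed
  then obtain u where u: "int p + int n * x = int p' * u" by (elim dvdE)
  have "int p dvd int q' * x"
  proof (rule int_dvd_if_prime_powers_dvd[OF pos(1)])
    fix \<pi> :: nat assume \<pi>: "Factorial_Ring.prime \<pi>" "\<pi> dvd p"
    then have "\<pi> dvd r * n" using dvds by (metis dvd_trans dvd_mult2)
    then show "int (\<pi> ^ multiplicity \<pi> p) dvd int q' * x"
      using admissible_local(3)[OF x \<pi>(1)] by blast
  qed
  moreover have "coprime u (int r)"
  proof (rule ccontr)
    assume "\<not> coprime u (int r)"
    then have "gcd u (int r) \<noteq> 1" by (simp add: coprime_iff_gcd_eq_1)
    then have "nat (gcd u (int r)) \<noteq> 1" by linarith
    then obtain \<pi> :: nat where \<pi>: "Factorial_Ring.prime \<pi>" "\<pi> dvd nat (gcd u (int r))"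
      using prime_factor_nat by blast
    then have "int \<pi> dvd gcd u (int r)" by (simp add: nat_dvd_iff dvd_nat_abs_iff int_dvd_int_iff[symmetric] del: int_dvd_int_iff)
    then have *: "int \<pi> dvd u" "\<pi> dvd r" by (auto simp: gcd_greatest_iff)
    then have \<pi>r: "\<pi> dvd r * n" by simp
    note loc = admissible_local[OF x \<pi>(1) \<pi>r]
    have "multiplicity (int \<pi>) (int p' * u) = multiplicity (int \<pi>) (int p') + multiplicity (int \<pi>) u"
      using loc(1) u \<pi>(1) pos by (intro prime_elem_multiplicity_mult_distrib) auto
    moreover have "multiplicity (int \<pi>) (int p') = multiplicity \<pi> p'"
      using pos \<pi> by (intro multiplicity_int_nat) auto
    ultimately have "multiplicity (int \<pi>) u = 0"
      using loc(2) u by simp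
    moreover have "u \<noteq> 0" using loc(1) u by auto
    ultimately show False using * \<pi>(1) by (simp add: prime_elem_multiplicity_eq_zero_iff)
  qed
  ultimately show ?thesis using that u by blast
qed

section \<open>Existence of the integer x\<close>

text \<open>Solutions at the single primes are combined by the Chinese remainder theorem. Only a <
  a' needs work: with A = rn/(pq) and B = r/q, the power of \<pi> in A divides both B and
  \<pi>^(c-b'), because d \<le> a < a'. After dividing by it, the remaining factor of A is a unit
  modulo powers of \<pi>.\<close>

lemma admissible_ex: "\<exists>x. admissible r n p q p' q' x"
proof -
  let ?Q = "\<lambda>\<pi> x.
      (let a = multiplicity \<pi> p; a' = multiplicity \<pi> p'; b' = multiplicity \<pi> q';
           c = multiplicity \<pi> r; d = multiplicity \<pi> n
       in (a = a' \<longrightarrow> [x = 0] (mod int (\<pi> ^ (a + 1)))) \<and>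
          (a > a' \<longrightarrow> [x = int (\<pi> ^ (a' - d))] (mod int (\<pi> ^ (a' - d + 1)))) \<and>
          (a < a' \<longrightarrow> [int (r * n div (p * q)) * x + int (r div q) = int (\<pi> ^ (c - b'))]
                        (mod int (\<pi> ^ (c - b' + 1)))))"
  \<comment> \<open>This exponent is at least as large as the exponent of each of the three moduli,
    so a single congruence modulo \<pi>^E carries over whichever condition applies.\<close>
  define E where "E = (\<lambda>\<pi>. multiplicity \<pi> p + multiplicity \<pi> p' + multiplicity \<pi> r + 1)"
  have local: "\<exists>y::nat. ?Q \<pi> (int y)" if \<pi>: "Factorial_Ring.prime \<pi>" for \<pi> :: nat
  proof -
    let ?P = "int \<pi>" and ?a = "multiplicity \<pi> p" and ?a' = "multiplicity \<pi> p'"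
      and ?b = "multiplicity \<pi> q" and ?b' = "multiplicity \<pi> q'"
      and ?c = "multiplicity \<pi> r" and ?d = "multiplicity \<pi> n"
    note rel = multiplicity_relations[OF \<pi>]
    consider "?a = ?a'" | "?a' < ?a" | "?a < ?a'" by linarith
    then show ?thesis
    proof cases
      case 1
      then show ?thesis by (intro exI[of _ 0]) (simp add: Let_def)
    next
      case 2
      then show ?thesis by (intro exI[of _ "\<pi> ^ (?a' - ?d)"]) (simp add: Let_def)
    next
      case 3
      let ?A = "r * n div (p * q)" and ?m = "?P ^ (?c - ?b' + 1)" and ?B = "r div q"
      have m: "multiplicity \<pi> (k * l) = multiplicity \<pi> k + multiplicity \<pi> l" if "k > 0" "l > 0" for k l
        using that \<pi> by (simp add: prime_elem_multiplicity_mult_distrib)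
      have A: "?A > 0" using pq_dvd r n by (metis dvd_div_eq_0_iff mult_eq_0_iff neq0_conv)
      have B: "?B > 0" using dvds r by (metis dvd_div_eq_0_iff neq0_conv)
      have "?a + ?b + multiplicity \<pi> ?A = ?c + ?d"
        using arg_cong[OF dvd_mult_div_cancel[OF pq_dvd], of "multiplicity \<pi>"] m pos A r n by simp
      moreover have "?b + multiplicity \<pi> ?B = ?c"
        using arg_cong[OF dvd_mult_div_cancel[OF dvds(3)], of "multiplicity \<pi>"] m pos B by simp
      moreover have "?d \<le> ?a" using 3 rel by (auto simp: min_def split: if_splits)
      ultimately have le: "multiplicity \<pi> ?A \<le> multiplicity \<pi> ?B" "multiplicity \<pi> ?A \<le> ?c - ?b'"
        using rel 3 by linarith+
      obtain A' where A': "?A = \<pi> ^ multiplicity \<pi> ?A * A'" "\<not> \<pi> dvd A'"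
        using multiplicity_decompose' A \<pi> by (metis less_numeral_extra(3) not_prime_unit)
      have "coprime A' \<pi>"
        using prime_imp_coprime[OF \<pi> A'(2)] by (simp add: coprime_commute)
      then have "coprime (int A') ?m" by simp
      then obtain z where z: "[int A' * z = 1] (mod ?m)" using cong_solve_coprime_int by blast
      have "?P ^ multiplicity \<pi> ?A dvd ?P ^ (?c - ?b') - int ?B"
        using le by (metis dvd_diff le_imp_power_dvd int_dvd_int_iff multiplicity_dvd' of_nat_power)
      then obtain t where t: "?P ^ (?c - ?b') - int ?B = ?P ^ multiplicity \<pi> ?A * t" by (elim dvdE)
      have "int ?A * (z * t) = int (\<pi> ^ multiplicity \<pi> ?A * A') * (z * t)"
        using A'(1) by presburger
      also have "\<dots> = (int A' * z) * (?P ^ multiplicity \<pi> ?A * t)" by (simp add: algebra_simps)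
      also have "[\<dots> = 1 * (?P ^ multiplicity \<pi> ?A * t)] (mod ?m)"
        using z by (rule cong_scalar_right)
      finally have zt: "[int ?A * (z * t) + int ?B = ?P ^ (?c - ?b')] (mod ?m)"
        using t by (metis cong_add_rcancel diff_add_cancel mult_1)
      have m0: "?m > 0" using \<pi> by (simp add: prime_gt_0_nat)
      \<comment> \<open>A nonnegative representative is taken, since the Chinese remainder theorem
        is applied to natural numbers.\<close>
      define y where "y = nat (z * t mod ?m)"
      have "int y = z * t mod ?m" using m0 by (simp add: y_def)
      then have "[int y = z * t] (mod ?m)" by (simp add: cong_def)
      then have "[int ?A * int y + int ?B = int ?A * (z * t) + int ?B] (mod ?m)"
        by (intro cong_add cong_scalar_left cong_refl)
      with zt have "[int ?A * int y + int ?B = ?P ^ (?c - ?b')] (mod ?m)"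
        by (rule cong_trans[rotated])
      then show ?thesis using 3 by (intro exI[of _ y]) (simp add: Let_def)
    qed
  qed
  then obtain y :: "nat \<Rightarrow> nat" where y: "\<And>\<pi>. Factorial_Ring.prime \<pi> \<Longrightarrow> ?Q \<pi> (int (y \<pi>))"
    by metis
  have "\<exists>x. \<forall>\<pi> \<in> prime_factors (r * n). [x = y \<pi>] (mod \<pi> ^ E \<pi>)"
    by (rule chinese_remainder_nat) (auto intro!: primes_coprime coprime_power_left_iff[THEN iffD2])
  then obtain x where x: "\<And>\<pi>. Factorial_Ring.prime \<pi> \<Longrightarrow> \<pi> dvd r * n \<Longrightarrow> [x = y \<pi>] (mod \<pi> ^ E \<pi>)"
    using r n by (auto simp: prime_factors_dvd)
  have "?Q \<pi> (int x)" if \<pi>: "Factorial_Ring.prime \<pi>" "\<pi> dvd r * n" for \<pi>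
  proof -
    have *: "[int x = int (y \<pi>)] (mod int (\<pi> ^ k))" if "k \<le> E \<pi>" for k
      using x[OF \<pi>] that by (metis cong_dvd_modulus_nat cong_int_iff le_imp_power_dvd)
    have **: "[int l * int x + m = int l * int (y \<pi>) + m] (mod int (\<pi> ^ k))" if "k \<le> E \<pi>" for k l m
      using *[OF that] by (intro cong_add cong_scalar_left cong_refl)
    have e: "multiplicity \<pi> p + 1 \<le> E \<pi>" "multiplicity \<pi> p' - multiplicity \<pi> n + 1 \<le> E \<pi>"
      "multiplicity \<pi> r - multiplicity \<pi> q' + 1 \<le> E \<pi>"
      by (simp_all add: E_def)
    show ?thesis
      using y[OF \<pi>(1)] *[OF e(1)] *[OF e(2)] **[OF e(3), of "r * n div (p * q)" "int (r div q)"]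
      unfolding Let_def by (meson cong_trans)
  qed
  then show ?thesis unfolding admissible_def by blast
qed

end

section \<open>Monomial matrices\<close>

lemma sum_int_permutes: "\<tau> permutes {..<n} \<Longrightarrow> (\<Sum>j<n. x (\<tau> j)) = (\<Sum>j<n. x j :: int)" for n :: nat
  using sum.permute[of \<tau> "{..<n}" x] by (simp add: o_def)

text \<open>Column j of the second factor has its only nonzero entry in row \<tau>(j), so it selects
  column \<tau>(j) of the first factor. This is the multiplication of the semidirect product of
  \<open>(\<int>/r)^n\<close> with the symmetric group.\<close>

lemma monomial_mat_mult:
  assumes "\<tau> permutes {..<n}"
  shows "monomial_mat r n \<sigma> x * monomial_mat r n \<tau> y
    = monomial_mat r n (\<sigma> \<circ> \<tau>) (\<lambda>j. x (\<tau> j) + y j)" (is "?A * ?B = ?C")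
proof (rule eq_matI)
  fix i j assume "i < dim_row ?C" "j < dim_col ?C"
  then have ij: "i < n" "j < n" by (auto simp: monomial_mat_def)
  have t: "\<tau> j < n" using permutes_in_image[OF assms, of j] ij by simp
  have "(?A * ?B) $$ (i, j) = (\<Sum>k<n. ?A $$ (i, k) * ?B $$ (k, j))"
    using ij by (simp add: monomial_mat_def scalar_prod_def lessThan_atLeast0)
  also have "\<dots> = (\<Sum>k<n. if k = \<tau> j then ?A $$ (i, \<tau> j) * zeta r powi y j else 0)"
    using ij by (intro sum.cong) (auto simp: monomial_mat_def)
  also have "\<dots> = ?C $$ (i, j)"
    using ij t by (simp add: monomial_mat_def power_int_add zeta_nonzero)
  finally show "(?A * ?B) $$ (i, j) = ?C $$ (i, j)" .
qed (simp_all add: monomial_mat_def)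

lemma one_mat_monomial: "1\<^sub>m n = monomial_mat r n id (\<lambda>_. 0)"
  by (auto simp: monomial_mat_def)

lemma c_elt_monomial: "c_elt r n = monomial_mat r n id (\<lambda>_. 1)"
  by (auto simp: monomial_mat_def c_elt_def)

lemma root_of_unity_zeta_powi:
  assumes "r > 0" "z ^ r = 1"
  shows "\<exists>k::int. z = zeta r powi k"
proof -
  have "z \<in> (\<lambda>k. cis (2 * pi * real k / real r)) ` {..<r}"
    using bij_betw_imp_surj_on[OF bij_betw_roots_unity[OF assms(1)]] assms(2) by blast
  then obtain k :: nat where "z = cis (2 * pi * real k / real r)" by auto
  then show ?thesis
    by (intro exI[of _ "int k"]) (simp only: zeta_powi of_int_of_nat_eq)
qed

lemma zeta_powi_power:
  assumes "r > 0"
  shows "(zeta r powi k) ^ r = 1"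
proof -
  have "(zeta r powi k) ^ r = zeta r powi (k * int r)"
    by (simp add: power_int_mult)
  also have "\<dots> = zeta r powi 0"
    using assms by (subst zeta_powi_eq_iff) (auto simp: cong_0_iff)
  finally show ?thesis by simp
qed

section \<open>The group G(r,n) and the powers of c\<close>

locale monomial_group =
  fixes r n :: nat
  assumes r: "r > 0" and n: "n > 0"
begin

abbreviation "G \<equiv> G_full r n"
abbreviation "M \<equiv> monomial_mat r n"
abbreviation cpow :: "int \<Rightarrow> complex mat" where "cpow k \<equiv> c_elt r n [^]\<^bsub>G\<^esub> k"

lemma mult_G [simp]: "g \<otimes>\<^bsub>G\<^esub> h = g * h" by (simp add: G_full_def)

lemma one_G: "\<one>\<^bsub>G\<^esub> = M id (\<lambda>_. 0)" by (simp add: G_full_def one_mat_monomial)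

lemma monomial_mat_closed:
  assumes s: "\<sigma> permutes {..<n}"
  shows "M \<sigma> x \<in> carrier G"
proof -
  have s': "inv_into UNIV \<sigma> i < n" "\<sigma> i < n" if "i < n" for i
    using permutes_in_image[OF s, of i] permutes_in_image[OF permutes_inv[OF s], of i] that by simp_all
  have nz: "M \<sigma> x $$ (i, j) \<noteq> 0 \<longleftrightarrow> i = \<sigma> j" if "i < n" "j < n" for i j
    using that by (simp add: monomial_mat_def zeta_nonzero)
  have "\<exists>!j. j < n \<and> M \<sigma> x $$ (i, j) \<noteq> 0" if "i < n" for i
    using that s' nz permutes_inverses[OF s] by (metis (no_types, lifting))
  moreover have "\<exists>!i. i < n \<and> M \<sigma> x $$ (i, j) \<noteq> 0" if "j < n" for j
    using that s' nz by (metis (no_types, lifting))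
  ultimately show ?thesis
    by (auto simp: G_full_def monomial_mat_def zeta_powi_power r)
qed

text \<open>The row of the unique nonzero entry in column j defines \<sigma>(j). Uniqueness within
  rows makes \<sigma> injective, hence a permutation of a finite set, and every rth root of unity is
  a power of \<open>zeta r\<close>. All later computations in the group use this normal
  form.\<close>

lemma carrier_GE:
  assumes "g \<in> carrier G"
  obtains \<sigma> x where "\<sigma> permutes {..<n}" "g = M \<sigma> x"
proof -
  have g: "g \<in> carrier_mat n n" "\<And>i. i < n \<Longrightarrow> \<exists>!j. j < n \<and> g $$ (i, j) \<noteq> 0"
    "\<And>j. j < n \<Longrightarrow> \<exists>!i. i < n \<and> g $$ (i, j) \<noteq> 0"
    "\<And>i j. i < n \<Longrightarrow> j < n \<Longrightarrow> g $$ (i, j) \<noteq> 0 \<Longrightarrow> g $$ (i, j) ^ r = 1"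
    using assms by (simp_all add: G_full_def)
  \<comment> \<open>Outside the index range \<sigma> is the identity, as \<open>permutes\<close>
    demands.\<close>
  define \<sigma> where "\<sigma> = (\<lambda>j. if j < n then (THE i. i < n \<and> g $$ (i, j) \<noteq> 0) else j)"
  have s: "\<sigma> j < n" "g $$ (\<sigma> j, j) \<noteq> 0" if "j < n" for j
    using theI'[OF g(3)[OF that]] that by (auto simp: \<sigma>_def)
  have inj: "inj_on \<sigma> {..<n}"
    using s g(2) by (intro inj_onI) (metis lessThan_iff)
  have "bij_betw \<sigma> {..<n} {..<n}"
    using inj s endo_inj_surj[of "{..<n}" \<sigma>] by (auto simp: bij_betw_def)
  then have p: "\<sigma> permutes {..<n}"
    by (intro bij_imp_permutes) (auto simp: \<sigma>_def)
  have "\<exists>k::int. g $$ (\<sigma> j, j) = zeta r powi k" if "j < n" for j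
    using root_of_unity_zeta_powi[OF r] g(4)[of "\<sigma> j" j] s that by blast
  then obtain x where x: "\<And>j. j < n \<Longrightarrow> g $$ (\<sigma> j, j) = zeta r powi x j" by metis
  have "g = M \<sigma> x"
  proof (rule eq_matI)
    fix i j assume "i < dim_row (M \<sigma> x)" "j < dim_col (M \<sigma> x)"
    then have ij: "i < n" "j < n" by (auto simp: monomial_mat_def)
    have "g $$ (i, j) = 0" if "i \<noteq> \<sigma> j"
      using g(3)[of j] s[of j] ij that by blast
    then show "g $$ (i, j) = M \<sigma> x $$ (i, j)"
      using ij x by (auto simp: monomial_mat_def)
  qed (use g(1) in \<open>auto simp: monomial_mat_def\<close>)
  with p that show thesis by blast
qed

lemma G_carrier_mat: "g \<in> carrier G \<Longrightarrow> g \<in> carrier_mat n n" by (simp add: G_full_def)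

sublocale G: group G
proof (rule groupI)
  fix g h assume "g \<in> carrier G" "h \<in> carrier G"
  then obtain \<sigma> x \<tau> y where "\<sigma> permutes {..<n}" "g = M \<sigma> x" "\<tau> permutes {..<n}" "h = M \<tau> y"
    by (metis carrier_GE)
  then show "g \<otimes>\<^bsub>G\<^esub> h \<in> carrier G"
    by (simp add: monomial_mat_mult monomial_mat_closed permutes_compose)
next
  show "\<one>\<^bsub>G\<^esub> \<in> carrier G" by (simp add: one_G monomial_mat_closed permutes_id)
next
  fix f g h assume "f \<in> carrier G" "g \<in> carrier G" "h \<in> carrier G"
  then show "f \<otimes>\<^bsub>G\<^esub> g \<otimes>\<^bsub>G\<^esub> h = f \<otimes>\<^bsub>G\<^esub> (g \<otimes>\<^bsub>G\<^esub> h)"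
    by (simp add: assoc_mult_mat[OF G_carrier_mat G_carrier_mat G_carrier_mat])
next
  fix g assume "g \<in> carrier G"
  from left_mult_one_mat[OF G_carrier_mat[OF this]] show "\<one>\<^bsub>G\<^esub> \<otimes>\<^bsub>G\<^esub> g = g"
    by (simp add: G_full_def)
next
  fix g assume "g \<in> carrier G"
  then obtain \<sigma> x where g: "\<sigma> permutes {..<n}" "g = M \<sigma> x" by (metis carrier_GE)
  \<comment> \<open>In column j of the product the exponents - x j and x j cancel.\<close>
  have "M (inv_into UNIV \<sigma>) (\<lambda>i. - x (inv_into UNIV \<sigma> i)) \<otimes>\<^bsub>G\<^esub> g = \<one>\<^bsub>G\<^esub>"
    using g by (simp add: monomial_mat_mult one_G permutes_inverses permutes_inv_o)
  then show "\<exists>h\<in>carrier G. h \<otimes>\<^bsub>G\<^esub> g = \<one>\<^bsub>G\<^esub>"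
    using monomial_mat_closed[OF permutes_inv[OF g(1)]] by blast
qed

lemma c_closed [simp]: "c_elt r n \<in> carrier G"
  by (simp add: c_elt_monomial monomial_mat_closed permutes_id)

lemma cpow_closed [simp]: "cpow k \<in> carrier G" by simp

lemma cpow_monomial: "cpow k = M id (\<lambda>_. k)"
proof -
  have nat: "c_elt r n [^]\<^bsub>G\<^esub> m = M id (\<lambda>_. int m)" for m :: nat
  proof (induction m)
    case (Suc m)
    then show ?case
      by (simp add: c_elt_monomial monomial_mat_mult permutes_id add.commute)
  qed (simp add: one_G id_def)
  have i: "M id (\<lambda>_. - l) = inv\<^bsub>G\<^esub> M id (\<lambda>_. l)" for l
    by (intro G.inv_equality[symmetric])
      (simp_all add: monomial_mat_mult permutes_id monomial_mat_closed one_G)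
  show ?thesis
    using i[of "- k"] by (simp add: int_pow_def2 nat)
qed

lemma cpow_add: "cpow k * cpow l = cpow (k + l)"
  using G.int_pow_mult[OF c_closed, of k l] by simp

lemma cpow_central: "g \<in> carrier G \<Longrightarrow> g * cpow k = cpow k * g"
  by (erule carrier_GE) (simp add: cpow_monomial monomial_mat_mult permutes_id add.commute)

text \<open>So c has order exactly r. The scalars are compared in the entry (0, 0), which exists
  because n > 0.\<close>

lemma cpow_eq_iff: "cpow k = cpow l \<longleftrightarrow> [k = l] (mod int r)"
proof
  assume "cpow k = cpow l"
  then have "cpow k $$ (0, 0) = cpow l $$ (0, 0)" by simp
  then show "[k = l] (mod int r)"
    using n by (simp add: cpow_monomial monomial_mat_def zeta_powi_eq_iff[OF r])
next
  assume "[k = l] (mod int r)"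
  then have "zeta r powi k = zeta r powi l" by (simp add: zeta_powi_eq_iff[OF r])
  then show "cpow k = cpow l" unfolding cpow_monomial monomial_mat_def by presburger
qed

lemma cpow_assoc: "g \<in> carrier G \<Longrightarrow> g * cpow k * cpow l = g * cpow (k + l)"
  using G.m_assoc[of g "cpow k" "cpow l"] by (simp add: cpow_add)

section \<open>Representatives of \<Delta>\<close>

lemma mem_Delta_monomial:
  "\<sigma> permutes {..<n} \<Longrightarrow> k \<in> Delta r n (M \<sigma> x) \<longleftrightarrow> [k = (\<Sum>i<n. x i)] (mod int r)"
  by (simp add: Delta_monomial_mat[OF r] mem_ZMod_iff)

lemma Delta_ex: "g \<in> carrier G \<Longrightarrow> \<exists>k. k \<in> Delta r n g"
  by (erule carrier_GE) (auto simp: mem_Delta_monomial intro: cong_refl)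

lemma Delta_cong:
  assumes "g \<in> carrier G" "k \<in> Delta r n g"
  shows "l \<in> Delta r n g \<longleftrightarrow> [l = k] (mod int r)"
proof -
  obtain \<sigma> x where "\<sigma> permutes {..<n}" "g = M \<sigma> x" using assms carrier_GE by blast
  with assms(2) show ?thesis by (metis mem_Delta_monomial cong_trans cong_sym)
qed

text \<open>In the product the exponents of g are reindexed by a permutation, which preserves their
  sum; so \<Delta> is a homomorphism to \<int>/r.\<close>

lemma Delta_mult:
  assumes "g \<in> carrier G" "h \<in> carrier G" "k \<in> Delta r n g" "l \<in> Delta r n h"
  shows "k + l \<in> Delta r n (g * h)"
proof -
  obtain \<sigma> x \<tau> y where "\<sigma> permutes {..<n}" "g = M \<sigma> x" "\<tau> permutes {..<n}" "h = M \<tau> y"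
    using assms carrier_GE by metis
  with assms(3,4) show ?thesis
    by (simp add: monomial_mat_mult mem_Delta_monomial permutes_compose sum.distrib
        sum_int_permutes cong_add)
qed

lemma Delta_cpow: "int n * k \<in> Delta r n (cpow k)"
  by (simp add: cpow_monomial mem_Delta_monomial permutes_id)

lemma Delta_mult_cpow:
  "g \<in> carrier G \<Longrightarrow> k \<in> Delta r n g \<Longrightarrow> k + int n * l \<in> Delta r n (g * cpow l)"
  by (intro Delta_mult Delta_cpow) auto

section \<open>The subgroups G(r,p,n)\<close>

text \<open>As p divides r, divisibility by p is the same for all representatives of a class modulo
  r.\<close>

lemma G_sub_dvd:
  assumes "p dvd r" "g \<in> carrier (G_sub r p n)" "k \<in> Delta r n g"
  shows "int p dvd k"
proof -
  obtain y where y: "Delta r n g = ZMod (int r) (int p * y)"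
    using assms(2) by (auto simp: G_sub_def)
  then have "[k = int p * y] (mod int r)" using assms(3) by (simp add: mem_ZMod_iff)
  then have "[k = int p * y] (mod int p)"
    using assms(1) by (metis cong_dvd_modulus int_dvd_int_iff)
  then show ?thesis by (simp add: cong_dvd_iff)
qed

lemma G_sub_carrierI:
  assumes "g \<in> carrier G" "k \<in> Delta r n g" "int p dvd k"
  shows "g \<in> carrier (G_sub r p n)"
proof -
  obtain \<sigma> x where g: "\<sigma> permutes {..<n}" "g = M \<sigma> x" using assms carrier_GE by metis
  then have "Delta r n g = ZMod (int r) k"
    using assms(2) by (metis Delta_monomial_mat[OF r] mem_ZMod_iff cong_def zmod_imp_ZMod)
  then show ?thesis using assms by (auto simp: G_sub_def elim!: dvdE)
qed

lemma G_sub_carrierD: "g \<in> carrier (G_sub r p n) \<Longrightarrow> g \<in> carrier G"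
  by (simp add: G_sub_def)

lemma G_sub_eq: "G_sub r p n = G\<lparr>carrier := carrier (G_sub r p n)\<rparr>"
  by (simp add: G_sub_def)

lemma subgroup_G_sub:
  assumes p: "p dvd r"
  shows "subgroup (carrier (G_sub r p n)) G"
proof (rule G.subgroupI)
  show "carrier (G_sub r p n) \<subseteq> carrier G" using G_sub_carrierD by blast
  have "\<one>\<^bsub>G\<^esub> \<in> carrier (G_sub r p n)"
    using Delta_cpow[of 0] by (intro G_sub_carrierI[of _ 0]) auto
  then show "carrier (G_sub r p n) \<noteq> {}" by (metis empty_iff)
next
  fix g assume g: "g \<in> carrier (G_sub r p n)"
  note g' = G_sub_carrierD[OF g]
  obtain k l where kl: "k \<in> Delta r n g" "l \<in> Delta r n (inv\<^bsub>G\<^esub> g)"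
    using Delta_ex[OF g'] Delta_ex[OF G.inv_closed[OF g']] by metis
  \<comment> \<open>The product is the identity, so r and therefore p divides k + l; as p divides k,
    it divides l.\<close>
  then have "k + l \<in> Delta r n (g * inv\<^bsub>G\<^esub> g)" using g' by (intro Delta_mult) auto
  moreover have "g * inv\<^bsub>G\<^esub> g = cpow 0" using G.r_inv[OF g'] by simp
  ultimately have "[k + l = 0] (mod int r)"
    using Delta_cong[OF cpow_closed Delta_cpow[of 0], of "k + l"] by simp
  then have "int p dvd k + l" using p by (metis cong_0_iff dvd_trans int_dvd_int_iff)
  moreover have "int p dvd k" using G_sub_dvd[OF p g kl(1)] .
  ultimately have "int p dvd l" by (simp add: dvd_add_right_iff)
  then show "inv\<^bsub>G\<^esub> g \<in> carrier (G_sub r p n)" using g' kl G_sub_carrierI by blast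
next
  fix g h assume gh: "g \<in> carrier (G_sub r p n)" "h \<in> carrier (G_sub r p n)"
  note gh' = gh[THEN G_sub_carrierD]
  obtain k l where kl: "k \<in> Delta r n g" "l \<in> Delta r n h" using Delta_ex[OF gh'(1)] Delta_ex[OF gh'(2)] by metis
  then show "g \<otimes>\<^bsub>G\<^esub> h \<in> carrier (G_sub r p n)"
    using G_sub_dvd[OF p] gh gh' G_sub_carrierI[OF _ Delta_mult[OF gh' kl]] G.m_closed[OF gh'] by simp
qed

lemma group_G_sub: "p dvd r \<Longrightarrow> group (G_sub r p n)"
  using subgroup.subgroup_is_group[OF subgroup_G_sub G.is_group] G_sub_eq by metis

lemma mult_G_sub [simp]: "g \<otimes>\<^bsub>G_sub r p n\<^esub> h = g * h"
  by (simp add: G_sub_def G_full_def)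

section \<open>The central subgroups of powers of c and their cosets\<close>

lemma C_sub_eq:
  "C_sub r q n = range (\<lambda>k. cpow (int (r div q) * k))"
proof -
  have "(c_elt r n [^]\<^bsub>G\<^esub> (r div q)) [^]\<^bsub>G\<^esub> (k :: int) = cpow (int (r div q) * k)" for k
    using G.int_pow_pow[OF c_closed, of "int (r div q)" k] unfolding int_pow_int
    by simp
  then show ?thesis by (auto simp: C_sub_def G.generate_pow)
qed

text \<open>The exponent k matters only modulo r, and r/q divides r, so divisibility by r/q does not
  depend on how the power is written.\<close>

lemma cpow_mem_C_sub:
  assumes "q dvd r"
  shows "cpow k \<in> C_sub r q n \<longleftrightarrow> int (r div q) dvd k"
proof
  assume "cpow k \<in> C_sub r q n"
  then obtain l where "[k = int (r div q) * l] (mod int r)"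
    by (auto simp: C_sub_eq cpow_eq_iff)
  then have "[k = int (r div q) * l] (mod int (r div q))"
    using assms by (metis cong_dvd_modulus int_dvd_int_iff div_dvd_iff_mult dvd_triv_left dvd_div_mult_self)
  then show "int (r div q) dvd k" by (simp add: cong_dvd_iff)
qed (auto simp: C_sub_eq elim!: dvdE)

text \<open>The generator c^(r/q) has \<Delta> equal to n (r/q), and p divides this number because p
  q divides r n. Normality is then immediate from centrality.\<close>

lemma C_sub_normal:
  assumes "p dvd r" "q dvd r" "p * q dvd r * n"
  shows "C_sub r q n \<lhd> G_sub r p n"
proof -
  interpret S: group "G_sub r p n" by (rule group_G_sub[OF assms(1)])
  have "p dvd n * (r div q)"
  proof -
    obtain s where s: "r = q * s" using assms(2) by (elim dvdE)
    have q: "q > 0" using s r by (auto intro: Nat.gr0I)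
    have "q * p dvd q * (n * s)" using assms(3) s by (simp only: mult_ac)
    then show ?thesis using q s by simp
  qed
  then have "int p dvd int n * int (r div q)" by (metis int_dvd_int_iff of_nat_mult)
  then have "cpow (int (r div q) * k) \<in> carrier (G_sub r p n)" for k
    by (intro G_sub_carrierI[OF _ Delta_cpow]) (auto simp flip: mult.assoc)
  then have sub: "C_sub r q n \<subseteq> carrier (G_sub r p n)" by (auto simp: C_sub_eq)
  have "subgroup (C_sub r q n) G"
    unfolding C_sub_def by (intro G.generate_is_subgroup) simp
  then have "subgroup (C_sub r q n) (G_sub r p n)"
    using G.subgroup_incl[OF _ subgroup_G_sub[OF assms(1)] sub] G_sub_eq by metis
  moreover have "C_sub r q n #>\<^bsub>G_sub r p n\<^esub> g = g <#\<^bsub>G_sub r p n\<^esub> C_sub r q n"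
    if "g \<in> carrier (G_sub r p n)" for g
    using cpow_central[OF G_sub_carrierD[OF that]]
    by (auto simp: r_coset_def l_coset_def C_sub_eq)
  ultimately show ?thesis by (intro S.normalI) auto
qed

text \<open>The two elements differ by the central factor c^(l-k) in the subgroup. Membership is
  asked of the product g c^k: in the application g lies in G(r,p,n), while the cosets are taken in
  G(r,p',n).\<close>

lemma coset_cpow_eq:
  assumes "p dvd r" "q dvd r" "p * q dvd r * n"
    and "g \<in> carrier G" "g * cpow k \<in> carrier (G_sub r p n)" "int (r div q) dvd l - k"
  shows "C_sub r q n #>\<^bsub>G_sub r p n\<^esub> (g * cpow l) = C_sub r q n #>\<^bsub>G_sub r p n\<^esub> (g * cpow k)"
proof -
  interpret S: group "G_sub r p n" by (rule group_G_sub[OF assms(1)])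
  have "g * cpow l = g * cpow k * cpow (l - k)" using assms(4) by (simp add: cpow_assoc)
  also have "\<dots> = cpow (l - k) * (g * cpow k)"
    using cpow_central[OF G_sub_carrierD[OF assms(5)]] by simp
  finally have "g * cpow l \<in> C_sub r q n #>\<^bsub>G_sub r p n\<^esub> (g * cpow k)"
    using assms(6) cpow_mem_C_sub[OF assms(2), of "l - k"] by (auto simp: r_coset_def)
  then show ?thesis
    using S.repr_independence[OF _ assms(5)] C_sub_normal[OF assms(1-3)]
    by (metis normal_imp_subgroup)
qed

end

section \<open>The twisted projection\<close>

sublocale admissible_data \<subseteq> monomial_group r n
  by unfold_locales (fact r, fact n)

text \<open>The congruences at the primes are replaced by their global consequences. The parameter u
  is the unit by which the twist scales: it takes \<Delta> = p m to \<Delta> = p' u m.\<close>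

locale admissible_integer = admissible_data +
  fixes x u :: int
  assumes shift: "int p + int n * x = int p' * u"
    and coprime_u: "coprime u (int r)"
    and p_dvd: "int p dvd int q' * x"
begin

abbreviation "G\<^sub>p \<equiv> G_sub r p n"
abbreviation "G\<^sub>p' \<equiv> G_sub r p' n"
abbreviation "C \<equiv> C_sub r q n"
abbreviation "C' \<equiv> C_sub r q' n"
abbreviation "\<phi> \<equiv> phi r p p' q' n x"

lemma pq'_dvd: "p' * q' dvd r * n" using pq pq_dvd by simp

lemma twist_eq: "twist r p n x g k = g * cpow (k div int p * x)"
  by (simp add: twist_def)

section \<open>Well-definedness and multiplicativity\<close>

lemma Delta_twist:
  assumes g: "g \<in> carrier G\<^sub>p" and k: "k \<in> Delta r n g"
  shows "int p' * (k div int p * u) \<in> Delta r n (twist r p n x g k)"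
proof -
  have "k + int n * (k div int p * x) = k div int p * (int p + int n * x)"
    using G_sub_dvd[OF dvds(1) g k] by (simp add: distrib_left mult_ac)
  also have "\<dots> = int p' * (k div int p * u)" unfolding shift by (simp add: mult_ac)
  finally show ?thesis
    using Delta_mult_cpow[OF G_sub_carrierD[OF g] k, of "k div int p * x"] by (simp add: twist_eq)
qed

lemma twist_closed:
  assumes g: "g \<in> carrier G\<^sub>p" and k: "k \<in> Delta r n g"
  shows "twist r p n x g k \<in> carrier G\<^sub>p'"
  using G_sub_carrierI[OF _ Delta_twist[OF assms]] G_sub_carrierD[OF g] G.m_closed[OF _ cpow_closed]
  by (simp add: twist_eq)

text \<open>Any representative may be used in the description defining \<open>phi\<close>: if two of
  them differ by r t, the exponents of c differ by (r t/p) x, a multiple of r/q' because p divides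
  q' x.\<close>

lemma phi_eq:
  assumes g: "g \<in> carrier G\<^sub>p" and k: "k \<in> Delta r n g"
  shows "\<phi> g = C' #>\<^bsub>G\<^sub>p'\<^esub> twist r p n x g k"
  unfolding phi_def
proof (rule the_equality)
  show "\<exists>l\<in>Delta r n g. C' #>\<^bsub>G\<^sub>p'\<^esub> twist r p n x g k = C' #>\<^bsub>G\<^sub>p'\<^esub> twist r p n x g l"
    using k by blast
next
  fix Y assume "\<exists>l\<in>Delta r n g. Y = C' #>\<^bsub>G\<^sub>p'\<^esub> twist r p n x g l"
  then obtain l where l: "l \<in> Delta r n g" and Y: "Y = C' #>\<^bsub>G\<^sub>p'\<^esub> twist r p n x g l" by blast
  have "[l = k] (mod int r)" using Delta_cong[OF G_sub_carrierD[OF g] k] l by blast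
  then obtain t where "l - k = int r * t" by (metis cong_iff_dvd_diff dvd_def)
  moreover obtain k1 l1 where kl: "k = int p * k1" "l = int p * l1"
    using G_sub_dvd[OF dvds(1) g] k l by (metis dvd_def)
  ultimately have t: "int p * (l1 - k1) = int r * t" by (simp add: right_diff_distrib)
  obtain w where w: "int q' * x = int p * w" using p_dvd by (elim dvdE)
  have r': "int r = int q' * int (r div q')" using dvds by (metis dvd_mult_div_cancel of_nat_mult)
  \<comment> \<open>Multiplying by p q' avoids the quotient r t/p; the common factor is cancelled
    afterwards.\<close>
  have "(int p * int q') * ((l1 - k1) * x) = (int p * (l1 - k1)) * (int q' * x)" by (simp add: mult_ac)
  also have "\<dots> = (int p * int q') * (int (r div q') * (t * w))"
    unfolding t w by (subst r') (simp add: mult_ac)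
  finally have "(l1 - k1) * x = int (r div q') * (t * w)" using pos by simp
  moreover have "l div int p * x - k div int p * x = (l1 - k1) * x"
    using kl pos by (simp add: left_diff_distrib)
  ultimately have "int (r div q') dvd l div int p * x - k div int p * x"
    by (metis dvd_triv_left)
  then show "Y = C' #>\<^bsub>G\<^sub>p'\<^esub> twist r p n x g k"
    unfolding Y twist_eq
    by (rule coset_cpow_eq[OF dvds(2,4) pq'_dvd G_sub_carrierD[OF g]
          twist_closed[OF g k, unfolded twist_eq]])
qed

lemma normal_C: "C \<lhd> G\<^sub>p" and normal_C': "C' \<lhd> G\<^sub>p'"
  using C_sub_normal dvds pq_dvd pq'_dvd by blast+

text \<open>The sum k + l represents \<Delta>(g h), and division by p is additive on multiples of p.
  Centrality of c then makes the twist itself multiplicative for these representatives.\<close>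

lemma phi_mult:
  assumes g: "g \<in> carrier G\<^sub>p" and h: "h \<in> carrier G\<^sub>p"
  shows "\<phi> (g * h) = \<phi> g <#>\<^bsub>G\<^sub>p'\<^esub> \<phi> h"
proof -
  interpret S: group G\<^sub>p by (rule group_G_sub[OF dvds(1)])
  interpret C': normal C' G\<^sub>p' by (rule normal_C')
  note g' = G_sub_carrierD[OF g] and h' = G_sub_carrierD[OF h]
  obtain k l where k: "k \<in> Delta r n g" and l: "l \<in> Delta r n h"
    using Delta_ex[OF g'] Delta_ex[OF h'] by blast
  have gh: "g * h \<in> carrier G\<^sub>p" using S.m_closed[OF g h] by simp
  have "(k + l) div int p * x = k div int p * x + l div int p * x"
    using G_sub_dvd[OF dvds(1) g k] by (simp add: div_plus_div_distrib_dvd_left distrib_right)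
  \<comment> \<open>The two powers are written in swapped order, so that one use of centrality moves
    the power belonging to g in front of h.\<close>
  then have "twist r p n x (g * h) (k + l) = g * h * (cpow (l div int p * x) * cpow (k div int p * x))"
    by (simp add: twist_eq cpow_add add.commute)
  also have "\<dots> = g * (h * cpow (l div int p * x) * cpow (k div int p * x))"
    using G.m_assoc[OF g' h' G.m_closed[OF cpow_closed cpow_closed]]
      G.m_assoc[OF h' cpow_closed cpow_closed] by simp
  also have "\<dots> = g * (cpow (k div int p * x) * (h * cpow (l div int p * x)))"
    using cpow_central[OF G.m_closed[OF h' cpow_closed]] by simp
  also have "\<dots> = twist r p n x g k * twist r p n x h l"
    using g' h' G.m_assoc[OF g' cpow_closed G.m_closed[OF h' cpow_closed]] by (simp add: twist_eq)
  finally show ?thesis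
    using C'.rcos_sum[OF twist_closed[OF g k] twist_closed[OF h l]]
    by (simp add: phi_eq[OF g k] phi_eq[OF h l] phi_eq[OF gh Delta_mult[OF g' h' k l]])
qed

lemma phi_closed: "g \<in> carrier G\<^sub>p \<Longrightarrow> \<phi> g \<in> carrier (G_quot r p' q' n)"
  using Delta_ex[OF G_sub_carrierD] twist_closed
  by (metis G_quot_def carrier_FactGroup image_eqI phi_eq)

lemma phi_hom: "group_hom G\<^sub>p (G_quot r p' q' n) \<phi>"
proof -
  have "group (G_quot r p' q' n)"
    unfolding G_quot_def by (rule normal.factorgroup_is_group[OF normal_C'])
  moreover have "\<phi> \<in> hom G\<^sub>p (G_quot r p' q' n)"
    by (rule homI) (use phi_closed phi_mult in \<open>auto simp: G_quot_def\<close>)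
  ultimately show ?thesis
    using group_G_sub[OF dvds(1)] by (simp add: group_hom_def group_hom_axioms_def)
qed

text \<open>Let \<open>h\<close> be given. Since \<open>u\<close> is prime to \<open>r\<close>, some representative of \<open>\<Delta>(h)\<close> has the form
  \<open>t (p + n x)\<close>; then \<open>g = h c\<^bsup>-t x\<^esup>\<close> has \<open>\<Delta>(g) = t p\<close> and is mapped to the class of \<open>h\<close>.\<close>

lemma phi_surj: "\<phi> ` carrier G\<^sub>p = carrier (G_quot r p' q' n)"
proof
  show "\<phi> ` carrier G\<^sub>p \<subseteq> carrier (G_quot r p' q' n)" using phi_closed by blast
  show "carrier (G_quot r p' q' n) \<subseteq> \<phi> ` carrier G\<^sub>p"
  proof
    fix Y assume "Y \<in> carrier (G_quot r p' q' n)"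
    then obtain h where h: "h \<in> carrier G\<^sub>p'" and Y: "Y = C' #>\<^bsub>G\<^sub>p'\<^esub> h"
      by (auto simp: G_quot_def carrier_FactGroup)
    note h' = G_sub_carrierD[OF h]
    obtain k where k: "k \<in> Delta r n h" using Delta_ex[OF h'] by blast
    then obtain k1 where k1: "k = int p' * k1" using G_sub_dvd[OF dvds(2) h] by (metis dvd_def)
    \<comment> \<open>With v inverse to u modulo r and k = p' k1, the multiplier is t = v k1: then t
      (p + n x) = p' k1 u v is congruent to k.\<close>
    obtain v where "[u * v = 1] (mod int r)"
      using cong_solve_coprime_int[OF coprime_u] by blast
    then have "[k * (u * v) = k * 1] (mod int r)" by (rule cong_scalar_left)
    then have t: "(v * k1) * (int p + int n * x) \<in> Delta r n h"
      unfolding shift using Delta_cong[OF h' k] k1 by (simp add: mult_ac)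
    define g where "g = h * cpow (- (v * k1 * x))"
    have g': "g \<in> carrier G" using G.m_closed[OF h' cpow_closed] by (simp add: g_def)
    have "v * k1 * int p \<in> Delta r n g"
      using Delta_mult_cpow[OF h' t, of "- (v * k1 * x)"] by (simp add: g_def algebra_simps)
    moreover from this have g: "g \<in> carrier G\<^sub>p"
      using G_sub_carrierI[OF g'] by simp
    moreover have "twist r p n x g (v * k1 * int p) = h"
      using pos h' G.r_one[OF h'] by (simp add: twist_eq g_def cpow_assoc)
    ultimately have "\<phi> g = Y" using phi_eq Y by metis
    then show "Y \<in> \<phi> ` carrier G\<^sub>p" using g by blast
  qed
qed

section \<open>The kernel and the induced isomorphism\<close>

text \<open>Since n j represents \<Delta>(c^j), the left side concerns the twist of c^j. With e = n
  j/p, the relations p (j + e x) = j (p + n x) = p' u j and p q = p' q' give q' (j + e x) = u q j.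
  As u is a unit modulo r, r divides one side exactly when it divides q j.\<close>

lemma phi_cpow_mem:
  assumes j: "int p dvd int n * j"
  shows "cpow (j + int n * j div int p * x) \<in> C' \<longleftrightarrow> cpow j \<in> C"
proof -
  obtain e where e: "int n * j = int p * e" using j by (elim dvdE)
  have rq: "int r = int q * int (r div q)" "int r = int q' * int (r div q')"
    using dvds by (metis dvd_mult_div_cancel of_nat_mult)+
  have "int p * (j + e * x) = j * int p + (int n * j) * x" unfolding e by (simp add: algebra_simps)
  also have "\<dots> = j * (int p + int n * x)" by (simp add: algebra_simps)
  also have "\<dots> = int p' * (u * j)" unfolding shift by (simp add: mult_ac)
  finally have "int p * (int q' * (j + e * x)) = int (p' * q') * (u * j)"
    by (simp add: mult_ac)
  also have "\<dots> = int p * (u * (int q * j))" unfolding pq[symmetric] by (simp add: mult_ac)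
  finally have *: "int q' * (j + e * x) = u * (int q * j)" using pos by simp
  have "int (r div q') dvd j + e * x \<longleftrightarrow> int r dvd int q' * (j + e * x)"
    using pos by (subst rq(2)) simp
  also have "\<dots> \<longleftrightarrow> int r dvd int q * j"
    unfolding * using coprime_u by (simp add: coprime_dvd_mult_right_iff coprime_commute)
  also have "\<dots> \<longleftrightarrow> int (r div q) dvd j"
    using pos by (subst rq(1)) simp
  finally show ?thesis
    using e pos by (simp add: cpow_mem_C_sub dvds)
qed

text \<open>The identity of the quotient is the coset \<open>C'\<close> itself, so g is in the
  kernel iff its twist lies in \<open>C'\<close>. This makes g a power of c and reduces the claim to
  \<open>phi_cpow_mem\<close>.\<close>

lemma phi_kernel: "kernel G\<^sub>p (G_quot r p' q' n) \<phi> = C"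
proof -
  interpret S': group G\<^sub>p' by (rule group_G_sub[OF dvds(2)])
  have C'_sub: "subgroup C' G\<^sub>p'" and C_sub: "subgroup C G\<^sub>p"
    using normal_C normal_C' normal_imp_subgroup by blast+
  have phi: "\<phi> g = C' \<longleftrightarrow> twist r p n x g k \<in> C'" if "g \<in> carrier G\<^sub>p" "k \<in> Delta r n g" for g k
    using that phi_eq twist_closed S'.coset_join1 S'.coset_join2 C'_sub by metis
  have main: "\<phi> (cpow j) = C' \<longleftrightarrow> cpow j \<in> C" if g: "cpow j \<in> carrier G\<^sub>p" for j
  proof -
    have "twist r p n x (cpow j) (int n * j) = cpow (j + int n * j div int p * x)"
      by (simp add: twist_eq cpow_add)
    then show ?thesis
      using phi[OF g Delta_cpow] phi_cpow_mem G_sub_dvd[OF dvds(1) g Delta_cpow] by metis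
  qed
  have "g \<in> C" if g: "g \<in> carrier G\<^sub>p" "\<phi> g = C'" for g
  proof -
    note g' = G_sub_carrierD[OF g(1)]
    obtain k where k: "k \<in> Delta r n g" using Delta_ex[OF g'] by blast
    define m where "m = k div int p * x"
    \<comment> \<open>The twist of g lies in \<open>C'\<close> and is thus a power of c; multiplying
      by c^(-m) exhibits g as one.\<close>
    obtain l where l: "g * cpow m = cpow l"
      using phi[OF g(1) k] g(2) by (auto simp: twist_eq C_sub_eq m_def)
    have "g = g * cpow m * cpow (- m)" using g' G.r_one[OF g'] by (simp add: cpow_assoc)
    then have "g = cpow (l - m)" by (simp add: l cpow_add)
    with main g show ?thesis by metis
  qed
  moreover have "g \<in> carrier G\<^sub>p \<and> \<phi> g = C'" if g: "g \<in> C" for g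
  proof -
    have "g \<in> carrier G\<^sub>p" using g subgroup.subset[OF C_sub] by blast
    moreover obtain j where "g = cpow j" using g by (auto simp: C_sub_eq)
    ultimately show ?thesis using main g by metis
  qed
  ultimately show ?thesis by (auto simp: kernel_def G_quot_def)
qed

lemma phi_induced_iso:
  "\<exists>\<psi> \<in> iso (G_quot r p q n) (G_quot r p' q' n).
    \<forall>g \<in> carrier G\<^sub>p. \<psi> (C #>\<^bsub>G\<^sub>p\<^esub> g) = \<phi> g"
proof (intro bexI ballI)
  interpret \<phi>: group_hom G\<^sub>p "G_quot r p' q' n" \<phi> by (rule phi_hom)
  show "(\<lambda>X. the_elem (\<phi> ` X)) \<in> iso (G_quot r p q n) (G_quot r p' q' n)"
    using \<phi>.FactGroup_iso_set[OF phi_surj] by (simp add: phi_kernel G_quot_def[of r p q n])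
  fix g assume g: "g \<in> carrier G\<^sub>p"
  have C: "z \<in> carrier G\<^sub>p" "\<phi> z = \<one>\<^bsub>G_quot r p' q' n\<^esub>" if "z \<in> C" for z
    using that phi_kernel by (auto simp: kernel_def)
  have "\<phi> y = \<phi> g" if y: "y \<in> C #>\<^bsub>G\<^sub>p\<^esub> g" for y
  proof -
    obtain z where "z \<in> C" "y = z \<otimes>\<^bsub>G\<^sub>p\<^esub> g" using y by (auto simp: r_coset_def)
    then show ?thesis using \<phi>.hom_mult[OF C(1) g] C(2) phi_closed[OF g] by simp
  qed
  moreover have "g \<in> C #>\<^bsub>G\<^sub>p\<^esub> g"
    using group.rcos_self[OF group_G_sub[OF dvds(1)] g] normal_C normal_imp_subgroup by blast
  ultimately have "\<phi> ` (C #>\<^bsub>G\<^sub>p\<^esub> g) = {\<phi> g}" by blast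
  then show "the_elem (\<phi> ` (C #>\<^bsub>G\<^sub>p\<^esub> g)) = \<phi> g" by simp
qed

end

text \<open>Well-definedness appears as the clause on all representatives k: each of them yields the
  same coset, the value of \<open>phi\<close>. The final clause ties the isomorphism to
  \<open>phi\<close>, so that it is the induced one.\<close>

theorem theorem5p3:
  fixes r n p p' q q' :: nat
  assumes "r > 0" and "n > 0"
    and "p dvd r" and "p' dvd r" and "q dvd r" and "q' dvd r"
    and "p * q = p' * q'" and "p * q dvd r * n"
    and "gcd p n = gcd p' n" and "gcd q n = gcd q' n"
  shows "(\<exists>x. admissible r n p q p' q' x) \<and>
    (\<forall>x. admissible r n p q p' q' x \<longrightarrow>
      (\<forall>g \<in> carrier (G_sub r p n). \<forall>k \<in> Delta r n g.
         int p dvd k \<and>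
         twist r p n x g k \<in> carrier (G_sub r p' n) \<and>
         phi r p p' q' n x g = C_sub r q' n #>\<^bsub>G_sub r p' n\<^esub> twist r p n x g k) \<and>
      group_hom (G_sub r p n) (G_quot r p' q' n) (phi r p p' q' n x) \<and>
      phi r p p' q' n x ` carrier (G_sub r p n) = carrier (G_quot r p' q' n) \<and>
      kernel (G_sub r p n) (G_quot r p' q' n) (phi r p p' q' n x) = C_sub r q n \<and>
      (\<exists>\<psi> \<in> iso (G_quot r p q n) (G_quot r p' q' n).
         \<forall>g \<in> carrier (G_sub r p n).
           \<psi> (C_sub r q n #>\<^bsub>G_sub r p n\<^esub> g) = phi r p p' q' n x g))"
proof -
  interpret admissible_data r n p p' q q' using assms by unfold_locales
  show ?thesis
  proof (rule conjI[OF admissible_ex], intro allI impI)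
    fix x assume "admissible r n p q p' q' x"
    then obtain u where "int p + int n * x = int p' * u" "coprime u (int r)" "int p dvd int q' * x"
      by (rule admissible_imp)
    then interpret admissible_integer r n p p' q q' x u by unfold_locales
    show "(\<forall>g \<in> carrier G\<^sub>p. \<forall>k \<in> Delta r n g. int p dvd k \<and>
         twist r p n x g k \<in> carrier G\<^sub>p' \<and> \<phi> g = C' #>\<^bsub>G\<^sub>p'\<^esub> twist r p n x g k) \<and>
      group_hom G\<^sub>p (G_quot r p' q' n) \<phi> \<and>
      \<phi> ` carrier G\<^sub>p = carrier (G_quot r p' q' n) \<and>
      kernel G\<^sub>p (G_quot r p' q' n) \<phi> = C \<and>
      (\<exists>\<psi> \<in> iso (G_quot r p q n) (G_quot r p' q' n).
         \<forall>g \<in> carrier G\<^sub>p. \<psi> (C #>\<^bsub>G\<^sub>p\<^esub> g) = \<phi> g)"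
      using G_sub_dvd[OF dvds(1)] twist_closed phi_eq
      by (intro conjI ballI phi_hom phi_surj phi_kernel phi_induced_iso)
  qed
qed

end
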